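(* Let $\mathfrak b\in\mathcal B^d$ be a decreasing Borel subalgebra of $\mathfrak{gl}(m|2n)$. Set $X_{\mathfrak b}=X_{\mathfrak b_e}$ and suppose $\lambda\in\mathscr H(m|n)$ is $\mathfrak b$-generic. Then for all $M_{\mathfrak b}\in\mathcal C_{\mathfrak b}$ we have $$M_{\mathfrak b}\underline\lambda_{\mathfrak b}+X_{\mathfrak b}=M_0\underline\lambda_0+X_0.$$
   Context: The base field is $\mathbb C$; $m,n\ge0$ are integers, $\mathfrak g=\mathfrak{gl}(m|2n)$, $\mathfrak h$ the diagonal Cartan subalgebra, with basis $\epsilon_1,\dots,\epsilon_m,\delta_1,\dots,\delta_{2n}$ of $\mathfrak h^*$ dual to the standard basis; matrices of size $(m+n)\times(m+2n)$ act as linear maps $\mathfrak h^*\to\mathbb C^{m+n}$ in this basis and the standard basis $e_1,\dots,e_{m+n}$. $\mathscr H(m|n)$ is the set of partitions $\lambda$ with $\lambda_{m+1}\le n$; $\lambda'$ is the transpose. $W_\lambda$ is the irreducible finite-dimensional $\mathfrak g$-module whose highest weight with respect to the lower triangular Borel subalgebra $\mathfrak b^{\mathrm{op}}$ is $\underline\lambda_0=-\sum_{i=1}^m2\lambda_i\epsilon_i-\sum_{j=1}^n\mu_j(\delta_{2j-1}+\delta_{2j})$, $\mu_j=\max\{0,\lambda'_j-m\}$. For a Borel subalgebra $\mathfrak b\supseteq\mathfrak h$, $\underline\lambda_{\mathfrak b}$ is the $\mathfrak b$-highest weight of $W_\lambda$. A Borel subalgebra containing $\mathfrak h$ is encoded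 by the ordering $\xi_1,\dots,\xi_{m+2n}$ of $\{\epsilon_i,\delta_j\}$ such that $\xi_i-\xi_{i+1}$ are its simple roots ($\delta\epsilon$ sequence). $\mathcal B^d$ is the set of decreasing ones: the indices of the $\epsilon$'s and of the $\delta$'s each decrease from left to right. $\ell_{i,\mathfrak b}$ is the number of $\delta$'s to the right of $\epsilon_i$, and $j_k=j_{k,\mathfrak b}$ the number of $\epsilon$'s to the left of $\delta_k$; $\mathfrak b\in\mathcal B^d$ is determined by $\ell_{1,\mathfrak b}\le\dots\le\ell_{m,\mathfrak b}$. $\mathfrak b_e\in\mathcal B^d$ is defined by $\ell_{i,\mathfrak b_e}=2\lfloor\frac12\ell_{i,\mathfrak b}\rfloor$ for all $i$. Put $r_{\mathfrak b}=\sum_{i=1}^m\sum_{k=1}^{\ell_{i,\mathfrak b}}(\delta_k-\epsilon_i)$; the roots $\delta_k-\epsilon_i$ occurring are those used in the odd reflections leading from $\mathfrak b^{\mathrm{op}}$ to $\mathfrak b$. $\lambda$ is $\mathfrak b$-generic if all of them are subtracted in computing the highest weight, i.e. $\underline\lambda_{\mathfrak b}=\underline\lambda_0-r_{\mathfrak b}$ (equivalently $2\lambda_i\ge\ell_{i,\mathfrak b}$ for all $i$). $M_0$ is the matrix with $M_0\epsilon_i=-\frac12e_i$, $M_0\delta_{2k-1}=M_0\delta_{2k}=-\frac12e_{m+k}$. $\mathcal C$ is the set of all matrices $M_0+[\,0_{(m+n)\times m}\mid A\,]$ with $A$ an $(m+n)\times 2n$ matrix whose columns satisfy $A_{2k}=-A_{2k-1}$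 for $1\le k\le n$. $T_{\mathfrak b}=\{1\le k\le n: j_{2k}<j_{2k-1}\}$; for $k\in T_{\mathfrak b}$, $r_{odd,\mathfrak b,k}=(j_{2k-1}-j_{2k})\delta_{2k-1}-\sum_{i=m-j_{2k-1}+1}^{m-j_{2k}}\epsilon_i$; $\mathcal C_{\mathfrak b}=\{M\in\mathcal C: Mr_{odd,\mathfrak b,k}=0\ \forall k\in T_{\mathfrak b}\}$. The Weyl vector of a Borel subalgebra is half the sum of positive even roots minus half the sum of positive odd roots; $\rho_0$ and $\rho_{\mathfrak b_e}$ are those of $\mathfrak b^{\mathrm{op}}$ and $\mathfrak b_e$; $X_0=M_0\rho_0$ and $X_{\mathfrak b_e}=M_0\rho_{\mathfrak b_e}$. *)

theory Defs
  imports "Jordan_Normal_Form.Matrix"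
begin

text \<open>All indices are those of the mathematics, hence start at 1.  The standard basis of
  \<open>\<complex>\<close>(m|2n) is ordered with the m even vectors first.  An element of the dual of the diagonal
  Cartan subalgebra is its coordinate vector, of dimension m + 2n, in the basis
  \<open>\<epsilon>\<close>(1), ..., \<open>\<epsilon>\<close>(m), \<open>\<delta>\<close>(1), ..., \<open>\<delta>\<close>(2n).\<close>

datatype letter = Eps nat | Del nat

fun is_eps :: "letter \<Rightarrow> bool" where
  "is_eps (Eps i) = True"
| "is_eps (Del j) = False"

text \<open>0-based matrix index belonging to a letter.\<close>

fun pos :: "nat \<Rightarrow> letter \<Rightarrow> nat" where
  "pos m (Eps i) = i - 1"
| "pos m (Del j) = m + j - 1"

definition letters :: "nat \<Rightarrow> nat \<Rightarrow> letter set" where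
  "letters m n = Eps ` {1..m} \<union> Del ` {1..2 * n}"

definition wt :: "nat \<Rightarrow> nat \<Rightarrow> letter \<Rightarrow> complex vec" where
  "wt m n x = unit_vec (m + 2 * n) (pos m x)"

abbreviation eps :: "nat \<Rightarrow> nat \<Rightarrow> nat \<Rightarrow> complex vec" where
  "eps m n i \<equiv> wt m n (Eps i)"

abbreviation del :: "nat \<Rightarrow> nat \<Rightarrow> nat \<Rightarrow> complex vec" where
  "del m n j \<equiv> wt m n (Del j)"

abbreviation wsum :: "nat \<Rightarrow> nat \<Rightarrow> ('i \<Rightarrow> complex vec) \<Rightarrow> 'i set \<Rightarrow> complex vec" where
  "wsum m n \<equiv> finsum_vec TYPE(complex) (m + 2 * n)"

definition precedes :: "letter list \<Rightarrow> letter \<Rightarrow> letter \<Rightarrow> bool" where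
  "precedes \<xi> x y \<longleftrightarrow> (\<exists>p q. p < q \<and> q < length \<xi> \<and> \<xi> ! p = x \<and> \<xi> ! q = y)"

text \<open>A Borel subalgebra containing the Cartan subalgebra is encoded by its sequence of
  \<open>\<epsilon>\<close>'s and \<open>\<delta>\<close>'s; its positive roots are the differences x - y with x to the left of y.\<close>

definition borel_seqs :: "nat \<Rightarrow> nat \<Rightarrow> letter list set" where
  "borel_seqs m n = {\<xi>. distinct \<xi> \<and> set \<xi> = letters m n}"

definition borel_subalgebra :: "nat \<Rightarrow> nat \<Rightarrow> letter list \<Rightarrow> complex mat set" where
  "borel_subalgebra m n \<xi> = {X \<in> carrier_mat (m + 2 * n) (m + 2 * n).
     \<forall>x \<in> letters m n. \<forall>y \<in> letters m n.
       X $$ (pos m x, pos m y) \<noteq> 0 \<longrightarrow> x = y \<or> precedes \<xi> x y}"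

definition decreasing_borels :: "nat \<Rightarrow> nat \<Rightarrow> letter list set" where
  "decreasing_borels m n = {\<xi> \<in> borel_seqs m n.
     (\<forall>i i'. precedes \<xi> (Eps i) (Eps i') \<longrightarrow> i' < i) \<and>
     (\<forall>j j'. precedes \<xi> (Del j) (Del j') \<longrightarrow> j' < j)}"

definition b_op :: "nat \<Rightarrow> nat \<Rightarrow> letter list" where
  "b_op m n = map Del (rev [1..<2 * n + 1]) @ map Eps (rev [1..<m + 1])"

definition ell :: "nat \<Rightarrow> letter list \<Rightarrow> nat \<Rightarrow> nat" where
  "ell n b i = card {k \<in> {1..2 * n}. precedes b (Eps i) (Del k)}"

definition jj :: "nat \<Rightarrow> letter list \<Rightarrow> nat \<Rightarrow> nat" where
  "jj m b k = card {i \<in> {1..m}. precedes b (Eps i) (Del k)}"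

definition b_even :: "nat \<Rightarrow> nat \<Rightarrow> letter list \<Rightarrow> letter list" where
  "b_even m n b = (THE b'. b' \<in> decreasing_borels m n \<and>
     (\<forall>i \<in> {1..m}. ell n b' i = 2 * (ell n b i div 2)))"

definition root_wt :: "nat \<Rightarrow> nat \<Rightarrow> letter \<times> letter \<Rightarrow> complex vec" where
  "root_wt m n r = wt m n (fst r) - wt m n (snd r)"

definition even_pos :: "letter list \<Rightarrow> (letter \<times> letter) set" where
  "even_pos \<xi> = {(x, y). precedes \<xi> x y \<and> is_eps x = is_eps y}"

definition odd_pos :: "letter list \<Rightarrow> (letter \<times> letter) set" where
  "odd_pos \<xi> = {(x, y). precedes \<xi> x y \<and> is_eps x \<noteq> is_eps y}"

definition weyl_vector :: "nat \<Rightarrow> nat \<Rightarrow> letter list \<Rightarrow> complex vec" where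
  "weyl_vector m n \<xi> =
     (1/2) \<cdot>\<^sub>v wsum m n (root_wt m n) (even_pos \<xi>) - (1/2) \<cdot>\<^sub>v wsum m n (root_wt m n) (odd_pos \<xi>)"

definition r_sum :: "nat \<Rightarrow> nat \<Rightarrow> letter list \<Rightarrow> complex vec" where
  "r_sum m n b = wsum m n (\<lambda>i. wsum m n (\<lambda>k. del m n k - eps m n i) {1..ell n b i}) {1..m}"

text \<open>Parities are Booleans, with True for odd; the sum of two parities is \<open>\<noteq>\<close>.\<close>

definition gl :: "nat \<Rightarrow> nat \<Rightarrow> bool \<Rightarrow> complex mat set" where
  "gl m n p = {X \<in> carrier_mat (m + 2 * n) (m + 2 * n).
     \<forall>i < m + 2 * n. \<forall>j < m + 2 * n. X $$ (i, j) \<noteq> 0 \<longrightarrow> ((i < m) \<noteq> (j < m)) = p}"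

definition super_sign :: "bool \<Rightarrow> bool \<Rightarrow> complex" where
  "super_sign p q = (if p \<and> q then -1 else 1)"

definition super_bracket :: "bool \<Rightarrow> bool \<Rightarrow> complex mat \<Rightarrow> complex mat \<Rightarrow> complex mat" where
  "super_bracket p q X Y = X * Y - super_sign p q \<cdot>\<^sub>m (Y * X)"

text \<open>The underlying space of a supermodule is the whole type \<open>'v\<close>; \<open>grade\<close> gives its even and
  its odd part, \<open>act\<close> the action of matrices.\<close>

record 'v supermodule =
  scale :: "complex \<Rightarrow> 'v \<Rightarrow> 'v"
  grade :: "bool \<Rightarrow> 'v set"
  act :: "complex mat \<Rightarrow> 'v \<Rightarrow> 'v"

definition gl_supermodule :: "nat \<Rightarrow> nat \<Rightarrow> 'v::ab_group_add supermodule \<Rightarrow> bool" where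
  "gl_supermodule m n W \<longleftrightarrow>
     vector_space (scale W) \<and>
     (\<forall>p. module.subspace (scale W) (grade W p)) \<and>
     grade W False \<inter> grade W True = {0} \<and>
     (\<forall>v. \<exists>a \<in> grade W False. \<exists>b \<in> grade W True. v = a + b) \<and>
     (\<forall>X \<in> carrier_mat (m + 2 * n) (m + 2 * n). Vector_Spaces.linear (scale W) (scale W) (act W X)) \<and>
     (\<forall>X \<in> carrier_mat (m + 2 * n) (m + 2 * n). \<forall>Y \<in> carrier_mat (m + 2 * n) (m + 2 * n). \<forall>v.
        act W (X + Y) v = act W X v + act W Y v) \<and>
     (\<forall>c. \<forall>X \<in> carrier_mat (m + 2 * n) (m + 2 * n). \<forall>v.
        act W (c \<cdot>\<^sub>m X) v = scale W c (act W X v)) \<and>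
     (\<forall>p q. \<forall>X \<in> gl m n p. \<forall>v \<in> grade W q. act W X v \<in> grade W (p \<noteq> q)) \<and>
     (\<forall>p q. \<forall>X \<in> gl m n p. \<forall>Y \<in> gl m n q. \<forall>v.
        act W (super_bracket p q X Y) v =
          act W X (act W Y v) - scale W (super_sign p q) (act W Y (act W X v)))"

definition finite_dim :: "'v::ab_group_add supermodule \<Rightarrow> bool" where
  "finite_dim W \<longleftrightarrow> (\<exists>B. finite B \<and> module.span (scale W) B = UNIV)"

definition gl_subsupermodule :: "nat \<Rightarrow> nat \<Rightarrow> 'v::ab_group_add supermodule \<Rightarrow> 'v set \<Rightarrow> bool" where
  "gl_subsupermodule m n W U \<longleftrightarrow>
     module.subspace (scale W) U \<and>
     (\<forall>a \<in> grade W False. \<forall>b \<in> grade W True. a + b \<in> U \<longrightarrow> a \<in> U \<and> b \<in> U) \<and>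
     (\<forall>X \<in> carrier_mat (m + 2 * n) (m + 2 * n). \<forall>u \<in> U. act W X u \<in> U)"

definition irreducible_gl_supermodule :: "nat \<Rightarrow> nat \<Rightarrow> 'v::ab_group_add supermodule \<Rightarrow> bool" where
  "irreducible_gl_supermodule m n W \<longleftrightarrow>
     gl_supermodule m n W \<and> (UNIV :: 'v set) \<noteq> {0} \<and>
     (\<forall>U. gl_subsupermodule m n W U \<longrightarrow> U = {0} \<or> U = UNIV)"

text \<open>A highest weight vector for a Borel subalgebra spans a line on which the Cartan subalgebra
  acts by the weight and the nilradical by 0; the sum below is the value of the weight on the
  diagonal part of X.\<close>

definition is_highest_weight ::
  "nat \<Rightarrow> nat \<Rightarrow> 'v::ab_group_add supermodule \<Rightarrow> letter list \<Rightarrow> complex vec \<Rightarrow> bool" where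
  "is_highest_weight m n W \<xi> \<mu> \<longleftrightarrow> \<mu> \<in> carrier_vec (m + 2 * n) \<and>
     (\<exists>v. v \<noteq> 0 \<and> (\<forall>X \<in> borel_subalgebra m n \<xi>.
        act W X v = scale W (\<Sum>c < m + 2 * n. \<mu> $ c * X $$ (c, c)) v))"

text \<open>Meaningful for irreducible finite-dimensional \<open>W\<close>, where it is unique.\<close>

definition highest_weight ::
  "nat \<Rightarrow> nat \<Rightarrow> 'v::ab_group_add supermodule \<Rightarrow> letter list \<Rightarrow> complex vec" where
  "highest_weight m n W \<xi> = (THE \<mu>. is_highest_weight m n W \<xi> \<mu>)"

text \<open>A partition is a function on the positive integers; its value at 0 is normalised to 0.\<close>

definition is_partition :: "(nat \<Rightarrow> nat) \<Rightarrow> bool" where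
  "is_partition l \<longleftrightarrow> l 0 = 0 \<and> (\<forall>i \<ge> 1. l (Suc i) \<le> l i) \<and> finite {i. l i \<noteq> 0}"

definition transpose_part :: "(nat \<Rightarrow> nat) \<Rightarrow> nat \<Rightarrow> nat" where
  "transpose_part l j = card {i. 1 \<le> i \<and> j \<le> l i}"

definition hook_partitions :: "nat \<Rightarrow> nat \<Rightarrow> (nat \<Rightarrow> nat) set" where
  "hook_partitions m n = {l. is_partition l \<and> l (m + 1) \<le> n}"

definition mu_part :: "nat \<Rightarrow> (nat \<Rightarrow> nat) \<Rightarrow> nat \<Rightarrow> int" where
  "mu_part m l j = max 0 (int (transpose_part l j) - int m)"

definition lambda0 :: "nat \<Rightarrow> nat \<Rightarrow> (nat \<Rightarrow> nat) \<Rightarrow> complex vec" where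
  "lambda0 m n l =
     - wsum m n (\<lambda>i. (2 * of_nat (l i)) \<cdot>\<^sub>v eps m n i) {1..m}
     - wsum m n (\<lambda>j. of_int (mu_part m l j) \<cdot>\<^sub>v (del m n (2 * j - 1) + del m n (2 * j))) {1..n}"

text \<open>\<open>W\<close> is (a model of) the irreducible module attached to the partition \<open>l\<close>.\<close>

definition is_W :: "nat \<Rightarrow> nat \<Rightarrow> (nat \<Rightarrow> nat) \<Rightarrow> 'v::ab_group_add supermodule \<Rightarrow> bool" where
  "is_W m n l W \<longleftrightarrow> irreducible_gl_supermodule m n W \<and> finite_dim W \<and>
     is_highest_weight m n W (b_op m n) (lambda0 m n l)"

text \<open>Genericity of \<open>l\<close>, read off from a model \<open>W\<close> of its module.\<close>

definition generic ::
  "nat \<Rightarrow> nat \<Rightarrow> letter list \<Rightarrow> (nat \<Rightarrow> nat) \<Rightarrow> 'v::ab_group_add supermodule \<Rightarrow> bool" where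
  "generic m n b l W \<longleftrightarrow> highest_weight m n W b = lambda0 m n l - r_sum m n b"

definition M0 :: "nat \<Rightarrow> nat \<Rightarrow> complex mat" where
  "M0 m n = mat (m + n) (m + 2 * n)
     (\<lambda>(r, c). if r = (if c < m then c else m + (c - m) div 2) then - (1/2) else 0)"

text \<open>The matrix with an m-column zero block to the left of A; the lower two blocks have no rows.\<close>

definition zero_left :: "nat \<Rightarrow> nat \<Rightarrow> complex mat \<Rightarrow> complex mat" where
  "zero_left m n A = four_block_mat (0\<^sub>m (m + n) m) A (0\<^sub>m 0 m) (0\<^sub>m 0 (2 * n))"

text \<open>The library's \<open>col\<close> is 0-based, so column 2k is \<open>col A (2 * k - 1)\<close>.\<close>

definition CC :: "nat \<Rightarrow> nat \<Rightarrow> complex mat set" where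
  "CC m n = {M0 m n + zero_left m n A | A. A \<in> carrier_mat (m + n) (2 * n) \<and>
     (\<forall>k \<in> {1..n}. col A (2 * k - 1) = - col A (2 * k - 2))}"

definition T_set :: "nat \<Rightarrow> nat \<Rightarrow> letter list \<Rightarrow> nat set" where
  "T_set m n b = {k \<in> {1..n}. jj m b (2 * k) < jj m b (2 * k - 1)}"

definition r_odd :: "nat \<Rightarrow> nat \<Rightarrow> letter list \<Rightarrow> nat \<Rightarrow> complex vec" where
  "r_odd m n b k =
     (of_nat (jj m b (2 * k - 1)) - of_nat (jj m b (2 * k))) \<cdot>\<^sub>v del m n (2 * k - 1)
     - wsum m n (eps m n) {m - jj m b (2 * k - 1) + 1..m - jj m b (2 * k)}"

definition C_b :: "nat \<Rightarrow> nat \<Rightarrow> letter list \<Rightarrow> complex mat set" where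
  "C_b m n b = {M \<in> CC m n. \<forall>k \<in> T_set m n b. M *\<^sub>v r_odd m n b k = 0\<^sub>v (m + n)}"

text \<open>The shift X(b) is by convention \<open>X_shift m n b\<close>, taken from the even Borel subalgebra
  of b, and not \<open>X_vec m n b\<close>.\<close>

definition X_vec :: "nat \<Rightarrow> nat \<Rightarrow> letter list \<Rightarrow> complex vec" where
  "X_vec m n \<xi> = M0 m n *\<^sub>v weyl_vector m n \<xi>"

definition X_shift :: "nat \<Rightarrow> nat \<Rightarrow> letter list \<Rightarrow> complex vec" where
  "X_shift m n b = X_vec m n (b_even m n b)"

lemma M0_eps:
  assumes "i \<in> {1..m}"
  shows "M0 m n *\<^sub>v eps m n i = (- (1/2)) \<cdot>\<^sub>v unit_vec (m + n) (i - 1)"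
  using assms by (intro eq_vecI) (auto simp: M0_def wt_def)

lemma M0_del:
  assumes "k \<in> {1..n}" "j = 2 * k - 1 \<or> j = 2 * k"
  shows "M0 m n *\<^sub>v del m n j = (- (1/2)) \<cdot>\<^sub>v unit_vec (m + n) (m + k - 1)"
proof -
  have "(j - 1) div 2 = k - 1" "1 \<le> j" "j \<le> 2 * n" "1 \<le> k" using assms by auto
  then show ?thesis
    by (intro eq_vecI) (auto simp: M0_def wt_def)
qed

lemma pos_b_op:
  assumes "p < m + 2 * n"
  shows "pos m (b_op m n ! p) = m + 2 * n - 1 - p"
  using assms by (auto simp: b_op_def nth_append rev_nth simp del: upt_Suc)

lemma set_b_op: "set (b_op m n) = letters m n"
  by (auto simp: b_op_def letters_def simp del: upt_Suc)

lemma length_b_op: "length (b_op m n) = m + 2 * n"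
  by (simp add: b_op_def)

lemma precedes_b_op:
  assumes "x \<in> letters m n" "y \<in> letters m n"
  shows "precedes (b_op m n) x y \<longleftrightarrow> pos m y < pos m x"
proof -
  obtain p q where pq: "p < m + 2 * n" "b_op m n ! p = x" "q < m + 2 * n" "b_op m n ! q = y"
    using assms unfolding set_b_op[symmetric] in_set_conv_nth length_b_op by blast
  have "pos m x = m + 2 * n - 1 - p" "pos m y = m + 2 * n - 1 - q"
    using pos_b_op pq by blast+
  moreover have "p = p'" if "p' < m + 2 * n" "b_op m n ! p' = x" for p'
    using pos_b_op[OF that(1)] pos_b_op[OF pq(1)] that pq by simp
  moreover have "q = q'" if "q' < m + 2 * n" "b_op m n ! q' = y" for q'
    using pos_b_op[OF that(1)] pos_b_op[OF pq(3)] that pq by simp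
  ultimately have uniq: "precedes (b_op m n) x y \<longleftrightarrow> p < q"
    using pq unfolding precedes_def length_b_op by (metis less_trans)
  show ?thesis
    unfolding uniq using pq(1,3) \<open>pos m x = _\<close> \<open>pos m y = _\<close> by linarith
qed

lemma borel_b_op:
  "borel_subalgebra m n (b_op m n) =
     {X \<in> carrier_mat (m + 2 * n) (m + 2 * n).
       \<forall>i < m + 2 * n. \<forall>j < m + 2 * n. i < j \<longrightarrow> X $$ (i, j) = 0}"
proof -
  have surj: "\<exists>x \<in> letters m n. pos m x = i" if "i < m + 2 * n" for i
  proof (cases "i < m")
    case True
    then show ?thesis by (intro bexI[of _ "Eps (Suc i)"]) (auto simp: letters_def)
  next
    case False
    then show ?thesis
      using that by (intro bexI[of _ "Del (Suc (i - m))"]) (auto simp: letters_def)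
  qed
  have bound: "pos m x < m + 2 * n" if "x \<in> letters m n" for x
    using that by (auto simp: letters_def)
  have inj: "x = y" if "x \<in> letters m n" "y \<in> letters m n" "pos m x = pos m y" for x y
    using that by (auto simp: letters_def)
  have "(\<forall>x \<in> letters m n. \<forall>y \<in> letters m n.
           X $$ (pos m x, pos m y) \<noteq> 0 \<longrightarrow> x = y \<or> precedes (b_op m n) x y) \<longleftrightarrow>
        (\<forall>i < m + 2 * n. \<forall>j < m + 2 * n. i < j \<longrightarrow> X $$ (i, j) = 0)" (is "?L \<longleftrightarrow> ?R")
    for X :: "complex mat"
  proof
    assume L: ?L
    show ?R
    proof (intro allI impI)
      fix i j assume ij: "i < m + 2 * n" "j < m + 2 * n" "i < j"
      obtain x y where xy: "x \<in> letters m n" "y \<in> letters m n" "pos m x = i" "pos m y = j"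
        using surj ij by blast
      have "\<not> precedes (b_op m n) x y" "x \<noteq> y"
        using precedes_b_op[OF xy(1,2)] xy ij by auto
      then show "X $$ (i, j) = 0" using L xy by blast
    qed
  next
    assume R: ?R
    show ?L
    proof (intro ballI impI)
      fix x y assume xy: "x \<in> letters m n" "y \<in> letters m n" "X $$ (pos m x, pos m y) \<noteq> 0"
      then have "\<not> pos m x < pos m y" using R bound by blast
      then show "x = y \<or> precedes (b_op m n) x y"
        using precedes_b_op[OF xy(1,2)] inj[OF xy(1,2)] by linarith
    qed
  qed
  then show ?thesis unfolding borel_subalgebra_def by simp
qed

end

(* The weight of W for b is known by genericity, so the identity is one of linear algebra.  The
   Weyl vector of a decreasing Borel differs from that of b^op by r_b, so what is needed is
   M r_b = M_0 r_{b_e}.  Now r_b - r_{b_e} is the sum of the vectors r_{odd,b,k}, which M kills,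
   while r_{b_e} has equal coordinates at delta_{2k-1} and delta_{2k}, where M agrees with M_0. *)
theory Submission
  imports Defs
begin

section \<open>Precedence of letters in a sequence\<close>

lemma precedes_in_set:
  assumes "precedes \<xi> x y"
  shows "x \<in> set \<xi>" "y \<in> set \<xi>"
  using assms unfolding precedes_def by auto

lemma precedes_total:
  assumes "x \<in> set \<xi>" "y \<in> set \<xi>" "x \<noteq> y"
  shows "precedes \<xi> x y \<or> precedes \<xi> y x"
proof -
  obtain p q where "p < length \<xi>" "\<xi> ! p = x" "q < length \<xi>" "\<xi> ! q = y"
    using assms by (auto simp: in_set_conv_nth)
  moreover from this have "p < q \<or> q < p" using assms(3) by (metis linorder_neqE_nat)
  ultimately show ?thesis unfolding precedes_def by blast
qed

lemma precedes_trans: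
  assumes "distinct \<xi>" "precedes \<xi> x y" "precedes \<xi> y z"
  shows "precedes \<xi> x z"
proof -
  obtain p q where pq: "p < q" "q < length \<xi>" "\<xi> ! p = x" "\<xi> ! q = y"
    using assms(2) unfolding precedes_def by blast
  obtain q' r where qr: "q' < r" "r < length \<xi>" "\<xi> ! q' = y" "\<xi> ! r = z"
    using assms(3) unfolding precedes_def by blast
  have "q = q'" using pq qr assms(1) nth_eq_iff_index_eq[of \<xi> q q'] by auto
  then have "p < r" using pq qr by simp
  then show ?thesis using pq qr unfolding precedes_def by blast
qed

lemma precedes_irrefl: "distinct \<xi> \<Longrightarrow> \<not> precedes \<xi> x x"
  unfolding precedes_def by (metis less_irrefl less_trans nth_eq_iff_index_eq)

lemma precedes_asym:
  assumes "distinct \<xi>" "precedes \<xi> x y"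
  shows "\<not> precedes \<xi> y x"
  using precedes_trans[OF assms] precedes_irrefl[OF assms(1)] by blast

section \<open>Decreasing Borels and the counts \<open>ell\<close> and \<open>jj\<close>\<close>

lemma decreasing_borelsD:
  assumes "b \<in> decreasing_borels m n"
  shows "distinct b" "set b = letters m n"
    and "precedes b (Eps i) (Eps i') \<Longrightarrow> i' < i"
    and "precedes b (Del j) (Del j') \<Longrightarrow> j' < j"
  using assms unfolding decreasing_borels_def borel_seqs_def by auto

lemma Eps_in_letters [simp]: "Eps i \<in> letters m n \<longleftrightarrow> i \<in> {1..m}"
  and Del_in_letters [simp]: "Del k \<in> letters m n \<longleftrightarrow> k \<in> {1..2 * n}"
  by (auto simp: letters_def)

text \<open>Decreasingness only forbids one order of two \<epsilon>'s; since both occur in the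
  sequence, totality forces the other order.\<close>

lemma precedes_Eps_Eps:
  assumes b: "b \<in> decreasing_borels m n" and "i \<in> {1..m}" "i' \<in> {1..m}"
  shows "precedes b (Eps i) (Eps i') \<longleftrightarrow> i' < i"
  using decreasing_borelsD(3)[OF b] precedes_total[of "Eps i" b "Eps i'"]
    decreasing_borelsD(2)[OF b] assms(2,3)
  by (metis Eps_in_letters less_asym less_irrefl letter.inject(1))

lemma precedes_Del_Del:
  assumes b: "b \<in> decreasing_borels m n" and "j \<in> {1..2 * n}" "j' \<in> {1..2 * n}"
  shows "precedes b (Del j) (Del j') \<longleftrightarrow> j' < j"
  using decreasing_borelsD(4)[OF b] precedes_total[of "Del j" b "Del j'"]
    decreasing_borelsD(2)[OF b] assms(2,3)
  by (metis Del_in_letters less_asym less_irrefl letter.inject(2))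

text \<open>This turns a cardinality into an endpoint: \<open>ell\<close> and \<open>jj\<close> are
  counts, while the arguments below need the sets counted, which are initial segments or complements
  of such.\<close>

lemma down_closed_eq_atLeastAtMost:
  fixes S :: "nat set"
  assumes "S \<subseteq> {1..N}" and "\<And>k k'. k \<in> S \<Longrightarrow> 1 \<le> k' \<Longrightarrow> k' \<le> k \<Longrightarrow> k' \<in> S"
  shows "S = {1..card S}"
proof (cases "S = {}")
  case False
  have fin: "finite S" using assms(1) finite_subset by blast
  have "S = {1..Max S}"
    using assms Max_in[OF fin False] Max_ge[OF fin] by fastforce
  moreover from this have "card S = Max S" by (metis card_atLeastAtMost diff_Suc_1)
  ultimately show ?thesis by simp
qed simp

text \<open>To the right of \<delta>(k) stand all \<delta>'s of smaller index, so the indices of the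
  \<delta>'s to the right of \<epsilon>(i) form an initial segment, and its size
  \<open>ell n b i\<close> is its last element.\<close>

lemma precedes_Eps_Del:
  assumes b: "b \<in> decreasing_borels m n" and "i \<in> {1..m}" and k: "k \<in> {1..2 * n}"
  shows "precedes b (Eps i) (Del k) \<longleftrightarrow> k \<le> ell n b i"
proof -
  let ?S = "{k \<in> {1..2 * n}. precedes b (Eps i) (Del k)}"
  have "?S = {1..card ?S}"
  proof (rule down_closed_eq_atLeastAtMost)
    fix k k' assume k: "k \<in> ?S" and k': "1 \<le> k'" "k' \<le> k"
    show "k' \<in> ?S"
    proof (cases "k' = k")
      case False
      then have "precedes b (Del k) (Del k')"
        using precedes_Del_Del[OF b, of k k'] k k' by auto
      then show ?thesis
        using precedes_trans[OF decreasing_borelsD(1)[OF b]] k k' by auto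
    qed (use k in simp)
  qed auto
  then have "k \<in> ?S \<longleftrightarrow> k \<in> {1..ell n b i}" unfolding ell_def by simp
  then show ?thesis using k by auto
qed

lemma precedes_Del_Eps:
  assumes b: "b \<in> decreasing_borels m n" and "i \<in> {1..m}" and "k \<in> {1..2 * n}"
  shows "precedes b (Del k) (Eps i) \<longleftrightarrow> ell n b i < k"
proof -
  have "precedes b (Del k) (Eps i) \<longleftrightarrow> \<not> precedes b (Eps i) (Del k)"
    using precedes_asym[OF decreasing_borelsD(1)[OF b]] precedes_total[of "Eps i" b "Del k"]
      decreasing_borelsD(2)[OF b] assms(2,3) by auto
  then show ?thesis using precedes_Eps_Del[OF assms] by auto
qed

lemma ell_le: "ell n b i \<le> 2 * n"
proof -
  have "ell n b i \<le> card {1..2 * n}" unfolding ell_def by (rule card_mono) auto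
  then show ?thesis by simp
qed

text \<open>An \<epsilon> of larger index stands further left and so has at least the same
  \<delta>'s to its right.\<close>

lemma ell_mono:
  assumes b: "b \<in> decreasing_borels m n"
  shows "mono_on {1..m} (ell n b)"
proof (rule mono_onI)
  fix i i' assume i: "i \<in> {1..m}" "i' \<in> {1..m}" "i \<le> i'"
  show "ell n b i \<le> ell n b i'"
  proof (cases "i = i'")
    case False
    then have "precedes b (Eps i') (Eps i)"
      using precedes_Eps_Eps[OF b, of i' i] i by auto
    then have "precedes b (Eps i) (Del k) \<Longrightarrow> precedes b (Eps i') (Del k)" for k
      using precedes_trans[OF decreasing_borelsD(1)[OF b]] by blast
    then show ?thesis unfolding ell_def by (intro card_mono) auto
  qed simp
qed

lemma jj_eq_card_ell:
  assumes b: "b \<in> decreasing_borels m n" and "k \<in> {1..2 * n}"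
  shows "jj m b k = card {i \<in> {1..m}. k \<le> ell n b i}"
proof -
  have "{i \<in> {1..m}. precedes b (Eps i) (Del k)} = {i \<in> {1..m}. k \<le> ell n b i}"
    using precedes_Eps_Del[OF b _ assms(2)] by auto
  then show ?thesis by (simp add: jj_def)
qed

text \<open>By monotonicity of \<open>ell\<close> the \<epsilon>'s to the right of \<delta>(k) have
  an initial segment of indices, and \<open>jj m b k\<close> counts the remaining ones. This makes
  the index range of the \<epsilon>'s in \<open>r_odd\<close> a condition on
  \<open>ell\<close>.\<close>

lemma ell_less_iff:
  assumes b: "b \<in> decreasing_borels m n" and k: "k \<in> {1..2 * n}" and i: "i \<in> {1..m}"
  shows "ell n b i < k \<longleftrightarrow> i \<le> m - jj m b k"
proof -
  let ?S = "{i \<in> {1..m}. ell n b i < k}" and ?T = "{i \<in> {1..m}. k \<le> ell n b i}"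
  have "?S = {1..card ?S}"
  proof (rule down_closed_eq_atLeastAtMost)
    fix i i' assume "i \<in> ?S" "1 \<le> i'" "i' \<le> i"
    then show "i' \<in> ?S" using mono_onD[OF ell_mono[OF b], of i' i] by auto
  qed auto
  moreover have "card ?S = m - jj m b k"
  proof -
    have "?S = {1..m} - ?T" by auto
    then have "card ?S = card ({1..m} - ?T)" by (rule arg_cong)
    also have "\<dots> = card {1..m} - card ?T" by (rule card_Diff_subset) auto
    finally show ?thesis using jj_eq_card_ell[OF b k] by simp
  qed
  ultimately have "i \<in> ?S \<longleftrightarrow> i \<in> {1..m - jj m b k}" by simp
  then show ?thesis using i by auto
qed

section \<open>Existence and uniqueness of a decreasing Borel with given counts\<close>

text \<open>A decreasing Borel is the listing of the letters by decreasing key, where \<open>e i\<close> is the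
  number of \<open>\<delta>\<close>'s to the right of \<open>\<epsilon>\<close>(i).\<close>

fun letter_key :: "nat \<Rightarrow> (nat \<Rightarrow> nat) \<Rightarrow> letter \<Rightarrow> nat" where
  "letter_key m e (Eps i) = e i * (m + 1) + i"
| "letter_key m e (Del k) = k * (m + 1)"

text \<open>Monotonicity of \<open>e\<close> orders the first summands weakly, and the added index
  \<open>i\<close> breaks ties.\<close>

lemma letter_key_Eps_Eps:
  assumes "mono_on {1..m} e"
    and "i \<in> {1..m}" "i' \<in> {1..m}"
  shows "letter_key m e (Eps i) < letter_key m e (Eps i') \<longleftrightarrow> i < i'"
proof -
  have mono: "letter_key m e (Eps i) < letter_key m e (Eps i')"
    if "i \<in> {1..m}" "i' \<in> {1..m}" "i < i'" for i i'
    using mult_le_mono1[OF mono_onD[OF assms(1), of i i'], of "m + 1"] that by auto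
  show ?thesis
    using mono[of i i'] mono[of i' i] assms(2,3) by (metis less_asym less_irrefl linorder_neqE_nat)
qed

lemma letter_key_Del_Del: "letter_key m e (Del k) < letter_key m e (Del k') \<longleftrightarrow> k < k'"
  unfolding letter_key.simps mult_less_cancel2 by simp

text \<open>The factor \<open>m + 1\<close> leaves room for the indices 1, ..., m: the key of
  \<epsilon>(i) lies strictly between those of \<delta>(e i) and \<delta>(e i + 1).\<close>

lemma letter_key_Del_Eps:
  assumes "i \<in> {1..m}"
  shows "letter_key m e (Del k) < letter_key m e (Eps i) \<longleftrightarrow> k \<le> e i"
proof (cases "k \<le> e i")
  case True
  then show ?thesis using mult_le_mono1[OF True, of "m + 1"] assms by auto
next
  case False
  then have "(e i + 1) * (m + 1) \<le> k * (m + 1)" by (intro mult_le_mono1) simp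
  then show ?thesis using False assms by simp
qed

lemma letter_key_Eps_Del:
  assumes "i \<in> {1..m}"
  shows "letter_key m e (Eps i) < letter_key m e (Del k) \<longleftrightarrow> e i < k"
proof (cases "e i < k")
  case True
  then have "(e i + 1) * (m + 1) \<le> k * (m + 1)" by (intro mult_le_mono1) simp
  then show ?thesis using True assms by simp
next
  case False
  then show ?thesis using mult_le_mono1[of k "e i" "m + 1"] assms by auto
qed

lemma inj_on_letter_key:
  assumes "mono_on {1..m} e"
  shows "inj_on (letter_key m e) (letters m n)"
proof (rule inj_onI)
  fix x y assume xy: "x \<in> letters m n" "y \<in> letters m n" and eq: "letter_key m e x = letter_key m e y"
  have "letter_key m e x < letter_key m e y \<or> letter_key m e y < letter_key m e x" if "x \<noteq> y"
    using xy that
    by (cases x; cases y) (auto simp del: letter_key.simps simp: letter_key_Eps_Eps[OF assms]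
      letter_key_Del_Del letter_key_Del_Eps letter_key_Eps_Del)
  with eq show "x = y" by auto
qed

text \<open>Agreement of \<open>e\<close> with \<open>ell n b\<close> is asked only on 1, ..., m, so
  two Borels with equal counts can be compared through one common key.\<close>

lemma precedes_iff_letter_key:
  assumes b: "b \<in> decreasing_borels m n" and xy: "x \<in> letters m n" "y \<in> letters m n"
    and e: "\<And>i. i \<in> {1..m} \<Longrightarrow> ell n b i = e i"
  shows "precedes b x y \<longleftrightarrow> letter_key m e y < letter_key m e x"
proof -
  have mono: "mono_on {1..m} e"
    using ell_mono[OF b] e by (simp add: mono_on_def)
  show ?thesis
    using xy letter_key_Eps_Eps[OF mono] letter_key_Del_Del[of m e] letter_key_Del_Eps[of _ m e]
      letter_key_Eps_Del[of _ m e] precedes_Eps_Eps[OF b] precedes_Del_Del[OF b]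
      precedes_Del_Eps[OF b] precedes_Eps_Del[OF b] e
    by (cases x; cases y) (simp_all del: letter_key.simps)
qed

lemma decreasing_borel_sorted:
  assumes b: "b \<in> decreasing_borels m n" and e: "\<And>i. i \<in> {1..m} \<Longrightarrow> ell n b i = e i"
  shows "sorted_wrt (<) (rev (map (letter_key m e) b))"
proof -
  have "letter_key m e (b ! q) < letter_key m e (b ! p)" if "p < q" "q < length b" for p q
  proof -
    have "precedes b (b ! p) (b ! q)" using that unfolding precedes_def by blast
    then show ?thesis
      using precedes_iff_letter_key[OF b _ _ e] precedes_in_set decreasing_borelsD(2)[OF b] by blast
  qed
  then have "sorted_wrt (\<lambda>x y. letter_key m e y < letter_key m e x) b"
    by (simp add: sorted_wrt_iff_nth_less)
  then show ?thesis by (simp add: sorted_wrt_rev sorted_wrt_map)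
qed

text \<open>Both reversed key lists are strictly increasing with the same set of entries, hence
  equal; injectivity of the key carries this back to the letters.\<close>

lemma decreasing_borel_unique:
  assumes b: "b \<in> decreasing_borels m n" and b': "b' \<in> decreasing_borels m n"
    and eq: "\<And>i. i \<in> {1..m} \<Longrightarrow> ell n b i = ell n b' i"
  shows "b = b'"
proof -
  let ?key = "letter_key m (ell n b')"
  have "rev (map ?key b) = rev (map ?key b')"
    using decreasing_borelsD(2)[OF b] decreasing_borelsD(2)[OF b']
    by (intro strict_sorted_equal decreasing_borel_sorted[OF b] decreasing_borel_sorted[OF b'])
      (auto simp: eq)
  moreover have "inj_on ?key (set b \<union> set b')"
    using inj_on_letter_key[OF ell_mono[OF b'], of n]
      decreasing_borelsD(2)[OF b] decreasing_borelsD(2)[OF b'] by simp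
  ultimately show ?thesis by (simp add: inj_on_map_eq_map)
qed

lemma decreasing_borel_exists:
  assumes mono: "mono_on {1..m} e"
    and le: "\<And>i. i \<in> {1..m} \<Longrightarrow> e i \<le> 2 * n"
  shows "\<exists>b \<in> decreasing_borels m n. \<forall>i \<in> {1..m}. ell n b i = e i"
proof -
  let ?key = "letter_key m e"
  \<comment> \<open>\<open>b_op m n\<close> supplies a list of all letters. Sorting is ascending
    while a Borel has decreasing keys, hence the reversal.\<close>
  define b where "b = rev (sort_key ?key (b_op m n))"
  have set: "set b = letters m n" by (simp add: b_def set_b_op)
  have dist: "distinct b" by (auto simp: b_def b_op_def distinct_map inj_on_def)
  have sorted: "?key (b ! q) \<le> ?key (b ! p)" if "p < q" "q < length b" for p q
  proof -
    have "sorted_wrt (\<lambda>x y. ?key y \<le> ?key x) b"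
      using sorted_sort_key[of ?key "b_op m n"] by (simp add: b_def sorted_wrt_rev sorted_map)
    then show ?thesis using that by (simp add: sorted_wrt_iff_nth_less)
  qed
  have key: "?key y < ?key x" if "precedes b x y" for x y
  proof -
    have "?key y \<le> ?key x" using that sorted unfolding precedes_def by blast
    moreover have "x \<noteq> y" using that precedes_irrefl[OF dist] by blast
    ultimately show ?thesis
      using inj_on_letter_key[OF mono, of n] precedes_in_set[OF that] set
      unfolding inj_on_def by (metis nat_less_le)
  qed
  have key_iff: "precedes b x y \<longleftrightarrow> ?key y < ?key x" if "x \<in> letters m n" "y \<in> letters m n" for x y
    using key[of x y] key[of y x] precedes_total[of x b y] that set by fastforce
  have "i' < i" if "precedes b (Eps i) (Eps i')" for i i'
    using key[OF that] letter_key_Eps_Eps[OF mono, of i' i] precedes_in_set[OF that] set by simp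
  moreover have "j' < j" if "precedes b (Del j) (Del j')" for j j'
    using key[OF that] letter_key_Del_Del[of m e] by blast
  ultimately have "b \<in> decreasing_borels m n"
    unfolding decreasing_borels_def borel_seqs_def using dist set by blast
  moreover have "ell n b i = e i" if "i \<in> {1..m}" for i
  proof -
    have "{k \<in> {1..2 * n}. precedes b (Eps i) (Del k)} = {1..e i}"
      using key_iff[of "Eps i"] letter_key_Del_Eps[OF that, of e] le[OF that] that
      by (auto simp del: letter_key.simps)
    then show ?thesis unfolding ell_def by simp
  qed
  ultimately show ?thesis by blast
qed

text \<open>The definite description is legitimate: rounding the counts down to even numbers keeps
  them monotone and at most \<open>2 * n\<close>, so a decreasing Borel with these counts exists,
  and it is unique.\<close>

lemma b_even:
  assumes b: "b \<in> decreasing_borels m n"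
  shows b_even_decreasing: "b_even m n b \<in> decreasing_borels m n"
    and ell_b_even: "i \<in> {1..m} \<Longrightarrow> ell n (b_even m n b) i = 2 * (ell n b i div 2)"
proof -
  let ?P = "\<lambda>b'. b' \<in> decreasing_borels m n \<and> (\<forall>i \<in> {1..m}. ell n b' i = 2 * (ell n b i div 2))"
  have "\<exists>b' \<in> decreasing_borels m n. \<forall>i \<in> {1..m}. ell n b' i = 2 * (ell n b i div 2)"
  proof (rule decreasing_borel_exists)
    show "mono_on {1..m} (\<lambda>i. 2 * (ell n b i div 2))"
      using ell_mono[OF b] by (simp add: mono_on_def div_le_mono)
    show "2 * (ell n b i div 2) \<le> 2 * n" for i
      using ell_le[of n b i] by simp
  qed
  then have "\<exists>!b'. ?P b'" by (metis decreasing_borel_unique)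
  then have "?P (b_even m n b)" unfolding b_even_def by (rule theI')
  then show "b_even m n b \<in> decreasing_borels m n"
    "i \<in> {1..m} \<Longrightarrow> ell n (b_even m n b) i = 2 * (ell n b i div 2)" by blast+
qed

section \<open>Weights as coordinate vectors\<close>

lemma wt_carrier [simp]: "wt m n x \<in> carrier_vec (m + 2 * n)"
  by (simp add: wt_def)

lemma dim_wt [simp]: "dim_vec (wt m n x) = m + 2 * n"
  by (simp add: wt_def)

lemma root_wt_carrier [simp]: "root_wt m n r \<in> carrier_vec (m + 2 * n)"
  by (simp add: root_wt_def)

lemma wsum_carrier:
  "(\<And>i. i \<in> F \<Longrightarrow> f i \<in> carrier_vec (m + 2 * n)) \<Longrightarrow> wsum m n f F \<in> carrier_vec (m + 2 * n)"
  by (rule finsum_vec_closed) auto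

lemma wsum_index:
  assumes "finite F" "c < m + 2 * n" "\<And>i. i \<in> F \<Longrightarrow> f i \<in> carrier_vec (m + 2 * n)"
  shows "wsum m n f F $ c = (\<Sum>i\<in>F. f i $ c)"
  using assms by (intro index_finsum_vec) auto

lemma weyl_vector_carrier [simp]: "weyl_vector m n \<xi> \<in> carrier_vec (m + 2 * n)"
  unfolding weyl_vector_def by (intro minus_carrier_vec smult_carrier_vec[THEN iffD2] wsum_carrier) simp_all

lemma r_sum_carrier [simp]: "r_sum m n b \<in> carrier_vec (m + 2 * n)"
  unfolding r_sum_def by (intro wsum_carrier) simp

lemma r_odd_carrier [simp]: "r_odd m n b k \<in> carrier_vec (m + 2 * n)"
  unfolding r_odd_def by (intro minus_carrier_vec smult_carrier_vec[THEN iffD2] wsum_carrier) simp_all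

lemma lambda0_carrier [simp]: "lambda0 m n l \<in> carrier_vec (m + 2 * n)"
  unfolding lambda0_def
  by (intro minus_carrier_vec uminus_carrier_vec[THEN iffD2] wsum_carrier smult_carrier_vec[THEN iffD2]
      add_carrier_vec) simp_all

section \<open>Positive roots and Weyl vectors of decreasing Borels\<close>

lemma b_op_decreasing: "b_op m n \<in> decreasing_borels m n"
proof -
  have dist: "distinct (b_op m n)" by (auto simp: b_op_def distinct_map inj_on_def)
  have "pos m y < pos m x" if "precedes (b_op m n) x y" for x y
    using precedes_b_op[of x m n y] precedes_in_set[OF that] that by (simp add: set_b_op)
  then show ?thesis
    unfolding decreasing_borels_def borel_seqs_def using dist set_b_op by fastforce
qed

lemma ell_b_op:
  assumes "i \<in> {1..m}"
  shows "ell n (b_op m n) i = 0"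
proof -
  have "{k \<in> {1..2 * n}. precedes (b_op m n) (Eps i) (Del k)} = {}"
    using precedes_b_op[of "Eps i" m n] assms by auto
  then show ?thesis unfolding ell_def by (simp only: card.empty)
qed

text \<open>The order among the \<epsilon>'s and the order among the \<delta>'s are the same for all
  decreasing Borels. Hence Weyl vectors differ only in their odd part.\<close>

lemma even_pos_decreasing:
  assumes b: "b \<in> decreasing_borels m n" and b': "b' \<in> decreasing_borels m n"
  shows "even_pos b = even_pos b'"
proof -
  have "precedes b' x y"
    if "precedes b x y" "is_eps x = is_eps y" "b \<in> decreasing_borels m n" "b' \<in> decreasing_borels m n"
    for b b' x y
    using that precedes_in_set[OF that(1)] decreasing_borelsD(2)[OF that(3)]
    by (cases x; cases y) (auto simp: precedes_Eps_Eps precedes_Del_Del)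
  then show ?thesis using b b' unfolding even_pos_def by blast
qed

text \<open>Each pair (i, k) gives exactly one odd positive root, and \<open>ell\<close> decides its
  sign. The common index set makes the sums for different Borels comparable term by term.\<close>

lemma odd_pos_decreasing:
  assumes b: "b \<in> decreasing_borels m n"
  shows "odd_pos b = (\<lambda>(i, k). if k \<le> ell n b i then (Eps i, Del k) else (Del k, Eps i)) `
    ({1..m} \<times> {1..2 * n})" (is "_ = ?f ` ?P")
proof (intro equalityI subrelI)
  fix x y assume "(x, y) \<in> odd_pos b"
  then have xy: "precedes b x y" "is_eps x \<noteq> is_eps y" unfolding odd_pos_def by auto
  have letters: "x \<in> letters m n" "y \<in> letters m n"
    using precedes_in_set[OF xy(1)] decreasing_borelsD(2)[OF b] by auto
  show "(x, y) \<in> ?f ` ?P"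
  proof (cases x; cases y)
    fix i k assume "x = Eps i" "y = Del k"
    then show ?thesis
      using xy letters precedes_Eps_Del[OF b, of i k] by (intro image_eqI[of _ _ "(i, k)"]) auto
  next
    fix i k assume "x = Del k" "y = Eps i"
    then show ?thesis
      using xy letters precedes_Del_Eps[OF b, of i k] by (intro image_eqI[of _ _ "(i, k)"]) auto
  qed (use xy in simp_all)
next
  fix x y assume "(x, y) \<in> ?f ` ?P"
  then show "(x, y) \<in> odd_pos b"
    using precedes_Eps_Del[OF b] precedes_Del_Eps[OF b]
    unfolding odd_pos_def by (auto split: if_splits)
qed

lemma wsum_odd_pos:
  assumes b: "b \<in> decreasing_borels m n" and c: "c < m + 2 * n"
  shows "wsum m n (root_wt m n) (odd_pos b) $ c = (\<Sum>(i, k) \<in> {1..m} \<times> {1..2 * n}.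
    (if k \<le> ell n b i then -1 else 1) * (del m n k - eps m n i) $ c)"
proof -
  let ?f = "\<lambda>(i, k). if k \<le> ell n b i then (Eps i, Del k) else (Del k, Eps i)"
  have inj: "inj_on ?f ({1..m} \<times> {1..2 * n})"
    by (auto simp: inj_on_def split: if_splits)
  have "wsum m n (root_wt m n) (odd_pos b) $ c = (\<Sum>r \<in> odd_pos b. root_wt m n r $ c)"
    using c by (intro wsum_index) (simp_all add: odd_pos_decreasing[OF b])
  also have "\<dots> = (\<Sum>p \<in> {1..m} \<times> {1..2 * n}. root_wt m n (?f p) $ c)"
    unfolding odd_pos_decreasing[OF b] by (simp only: sum.reindex[OF inj] o_def)
  also have "\<dots> = (\<Sum>(i, k) \<in> {1..m} \<times> {1..2 * n}.
      (if k \<le> ell n b i then -1 else 1) * (del m n k - eps m n i) $ c)"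
    using c by (intro sum.cong) (auto simp: root_wt_def wt_def)
  finally show ?thesis .
qed

text \<open>Padding with zeros gives the sum the same index set as in
  \<open>wsum_odd_pos\<close>.\<close>

lemma r_sum_index:
  assumes c: "c < m + 2 * n"
  shows "r_sum m n b $ c = (\<Sum>(i, k) \<in> {1..m} \<times> {1..2 * n}.
    if k \<le> ell n b i then (del m n k - eps m n i) $ c else 0)"
proof -
  have "r_sum m n b $ c = (\<Sum>i = 1..m. \<Sum>k = 1..ell n b i. (del m n k - eps m n i) $ c)"
    unfolding r_sum_def using c
    by (simp add: wsum_index wsum_carrier del: index_minus_vec)
  also have "\<dots> = (\<Sum>i = 1..m. \<Sum>k = 1..2 * n. if k \<le> ell n b i then (del m n k - eps m n i) $ c else 0)"
  proof (rule sum.cong[OF refl])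
    fix i
    have "{1..ell n b i} = {k \<in> {1..2 * n}. k \<le> ell n b i}" using ell_le[of n b i] by auto
    then have "(\<Sum>k = 1..ell n b i. (del m n k - eps m n i) $ c) =
        (\<Sum>k \<in> {k \<in> {1..2 * n}. k \<le> ell n b i}. (del m n k - eps m n i) $ c)" by simp
    then show "(\<Sum>k = 1..ell n b i. (del m n k - eps m n i) $ c) =
        (\<Sum>k = 1..2 * n. if k \<le> ell n b i then (del m n k - eps m n i) $ c else 0)"
      by (simp only: sum.inter_filter finite_atLeastAtMost)
  qed
  finally show ?thesis by (simp only: sum.cartesian_product)
qed

text \<open>Each odd reflection adds its root to the Weyl vector.\<close>

lemma weyl_vector_decreasing:
  assumes b: "b \<in> decreasing_borels m n"
  shows "weyl_vector m n b = weyl_vector m n (b_op m n) + r_sum m n b"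
proof (rule eq_vecI)
  have dim: "dim_vec (weyl_vector m n b') = m + 2 * n" "dim_vec (r_sum m n b') = m + 2 * n" for b'
    using weyl_vector_carrier r_sum_carrier by (blast dest: carrier_vecD)+
  show "dim_vec (weyl_vector m n b) = dim_vec (weyl_vector m n (b_op m n) + r_sum m n b)"
    by (simp add: dim)
  fix c assume "c < dim_vec (weyl_vector m n (b_op m n) + r_sum m n b)"
  then have c: "c < m + 2 * n" by (simp add: dim)
  let ?P = "{1..m} \<times> {1..2 * n}"
  let ?D = "\<lambda>i k. (del m n k - eps m n i) $ c"
  let ?E = "wsum m n (root_wt m n) (even_pos b) $ c"
  have dimw: "dim_vec (wsum m n (root_wt m n) F) = m + 2 * n" for F
    by (rule carrier_vecD, rule wsum_carrier) simp
  \<comment> \<open>The even part \<open>?E\<close> is that of \<open>b\<close> for every decreasing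
    \<open>b'\<close>.\<close>
  have w: "weyl_vector m n b' $ c = 1/2 * ?E - 1/2 * (\<Sum>(i, k) \<in> ?P. (if k \<le> ell n b' i then -1 else 1) * ?D i k)"
    if "b' \<in> decreasing_borels m n" for b'
    unfolding weyl_vector_def wsum_odd_pos[OF that c, symmetric] even_pos_decreasing[OF b that]
    using c by (simp add: dimw)
  have "weyl_vector m n (b_op m n) $ c + r_sum m n b $ c = 1/2 * ?E -
      1/2 * (\<Sum>(i, k) \<in> ?P. (if k \<le> ell n (b_op m n) i then -1 else 1) * ?D i k) +
      (\<Sum>(i, k) \<in> ?P. if k \<le> ell n b i then ?D i k else 0)"
    by (simp only: w[OF b_op_decreasing] r_sum_index[OF c])
  also have "\<dots> = 1/2 * ?E - 1/2 * (\<Sum>(i, k) \<in> ?P. (if k \<le> ell n b i then -1 else 1) * ?D i k)"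
  proof -
    \<comment> \<open>All signs for \<open>b_op\<close> are +1, since its counts vanish. Passing to
      \<open>b\<close> flips the sign where \<open>k \<le> ell n b i\<close>, a change by twice the
      root, which the factor 1/2 of the Weyl vector halves.\<close>
    have "(\<Sum>(i, k) \<in> ?P. (if k \<le> ell n (b_op m n) i then -1 else 1) * ?D i k) =
        (\<Sum>(i, k) \<in> ?P. (if k \<le> ell n b i then -1 else 1) * ?D i k) +
        2 * (\<Sum>(i, k) \<in> ?P. if k \<le> ell n b i then ?D i k else 0)"
      unfolding sum_distrib_left sum.distrib[symmetric]
      by (rule sum.cong) (auto simp: ell_b_op simp del: index_minus_vec)
    then show ?thesis by (simp only: algebra_simps) simp
  qed
  finally show "weyl_vector m n b $ c = (weyl_vector m n (b_op m n) + r_sum m n b) $ c"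
    using c by (simp add: w[OF b] dim del: index_minus_vec)
qed

section \<open>Coordinates of \<open>r_sum\<close> and \<open>r_odd\<close>, and the passage to the
  even Borel\<close>

lemma r_sum_index_Eps:
  assumes c: "c < m"
  shows "r_sum m n b $ c = - of_nat (ell n b (Suc c))"
proof -
  have "r_sum m n b $ c =
      (\<Sum>i = 1..m. \<Sum>k = 1..2 * n. if k \<le> ell n b i then (del m n k - eps m n i) $ c else 0)"
    using c by (simp only: r_sum_index trans_less_add1 sum.cartesian_product)
  also have "\<dots> = (\<Sum>i = 1..m. if i = Suc c then - of_nat (ell n b (Suc c)) else 0)"
  proof (rule sum.cong[OF refl])
    fix i assume i: "i \<in> {1..m}"
    have "(\<Sum>k = 1..2 * n. if k \<le> ell n b i then (del m n k - eps m n i) $ c else 0) =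
        (\<Sum>k = 1..2 * n. if k \<le> ell n b i then (if i = Suc c then -1 else 0) else 0)"
      using c i by (intro sum.cong) (auto simp: wt_def)
    also have "\<dots> = (\<Sum>k \<in> {k \<in> {1..2 * n}. k \<le> ell n b i}. if i = Suc c then -1 else 0)"
      by (simp only: sum.inter_filter finite_atLeastAtMost)
    also have "{k \<in> {1..2 * n}. k \<le> ell n b i} = {1..ell n b i}"
      using ell_le[of n b i] by auto
    finally show "(\<Sum>k = 1..2 * n. if k \<le> ell n b i then (del m n k - eps m n i) $ c else 0) =
        (if i = Suc c then - of_nat (ell n b (Suc c)) else 0)"
      by (auto simp: sum_negf)
  qed
  also have "\<dots> = - of_nat (ell n b (Suc c))" using c by (simp add: sum.delta')
  finally show ?thesis .
qed

text \<open>The 0-based coordinate \<open>m + j\<close> belongs to \<delta>(j + 1), so the condition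
  \<open>j + 1 \<le> ell n b i\<close> appears as \<open>j < ell n b i\<close>.\<close>

lemma r_sum_index_Del:
  assumes j: "j < 2 * n"
  shows "r_sum m n b $ (m + j) = of_nat (card {i \<in> {1..m}. j < ell n b i})"
proof -
  have "r_sum m n b $ (m + j) =
      (\<Sum>i = 1..m. \<Sum>k = 1..2 * n. if k \<le> ell n b i then (del m n k - eps m n i) $ (m + j) else 0)"
    using j by (simp only: r_sum_index nat_add_left_cancel_less sum.cartesian_product)
  also have "\<dots> = (\<Sum>i = 1..m. \<Sum>k = 1..2 * n. if k = Suc j then (if j < ell n b i then 1 else 0) else 0)"
    using j by (intro sum.cong refl) (auto simp: wt_def)
  also have "\<dots> = (\<Sum>i = 1..m. if j < ell n b i then 1 else 0)"
    using j by simp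
  also have "\<dots> = (\<Sum>i \<in> {i \<in> {1..m}. j < ell n b i}. 1)"
    by (simp only: sum.inter_filter finite_atLeastAtMost)
  finally show ?thesis by simp
qed

lemma jj_antimono:
  assumes b: "b \<in> decreasing_borels m n" and "k \<in> {1..2 * n}" "k' \<in> {1..2 * n}" "k \<le> k'"
  shows "jj m b k' \<le> jj m b k"
  using assms(4) unfolding jj_eq_card_ell[OF b assms(2)] jj_eq_card_ell[OF b assms(3)]
  by (intro card_mono) auto

text \<open>By \<open>ell_less_iff\<close> the \<epsilon>'s subtracted are those with
  \<open>2 * k - 1 \<le> ell < 2 * k\<close>. The coordinate \<open>m + 2 * k - 2\<close> is the
  0-based place of \<delta>(2k-1).\<close>

lemma r_odd_index:
  assumes b: "b \<in> decreasing_borels m n" and k: "k \<in> {1..n}" and c: "c < m + 2 * n"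
  shows "r_odd m n b k $ c = (if c < m then if ell n b (Suc c) = 2 * k - 1 then -1 else 0
    else if c = m + 2 * k - 2 then of_nat (jj m b (2 * k - 1)) - of_nat (jj m b (2 * k)) else 0)"
proof -
  let ?I = "{m - jj m b (2 * k - 1) + 1..m - jj m b (2 * k)}"
  have I: "?I \<subseteq> {1..m}" by auto
  have carr: "wsum m n (eps m n) ?I \<in> carrier_vec (m + 2 * n)" by (rule wsum_carrier) simp
  have "wsum m n (eps m n) ?I $ c = (\<Sum>i \<in> ?I. eps m n i $ c)"
    using c by (intro wsum_index) simp_all
  also have "\<dots> = (\<Sum>i \<in> ?I. if i = Suc c then 1 else 0)"
    using c I by (intro sum.cong) (auto simp: wt_def)
  also have "\<dots> = (if Suc c \<in> ?I then 1 else 0)" by simp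
  also have "Suc c \<in> ?I \<longleftrightarrow> c < m \<and> ell n b (Suc c) = 2 * k - 1"
  proof (cases "c < m")
    case True
    have "2 * k - 1 \<in> {1..2 * n}" "2 * k \<in> {1..2 * n}" using k by auto
    then show ?thesis
      using ell_less_iff[OF b, of "2 * k - 1" "Suc c"] ell_less_iff[OF b, of "2 * k" "Suc c"] True
      by auto
  qed (use I in auto)
  finally have "wsum m n (eps m n) ?I $ c = (if c < m \<and> ell n b (Suc c) = 2 * k - 1 then 1 else 0)" .
  moreover have "del m n (2 * k - 1) $ c = (if c = m + 2 * k - 2 then 1 else 0)"
    using c k by (auto simp: wt_def)
  ultimately show ?thesis
    using c k carrier_vecD[OF carr] by (auto simp: r_odd_def)
qed

text \<open>Outside \<open>T_set\<close> the two values of \<open>jj\<close> coincide, which kills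
  the coefficient and empties the \<epsilon>-range. Sums of \<open>r_odd\<close> may therefore run
  over all of 1, ..., n.\<close>

lemma r_odd_eq_0:
  assumes b: "b \<in> decreasing_borels m n" and k: "k \<in> {1..n} - T_set m n b"
  shows "r_odd m n b k = 0\<^sub>v (m + 2 * n)"
proof -
  have "2 * k - 1 \<in> {1..2 * n}" "2 * k \<in> {1..2 * n}" using k by auto
  then have "jj m b (2 * k - 1) = jj m b (2 * k)"
    using jj_antimono[OF b, of "2 * k - 1" "2 * k"] k by (auto simp: T_set_def)
  then show ?thesis
    by (intro eq_vecI) (auto simp: r_odd_def finsum_vec_empty wt_def)
qed

text \<open>Coordinatewise: at \<epsilon>(i) the count and its even rounding differ by its parity;
  at \<delta>(2k-1) the two sums have \<open>jj\<close> at 2k-1 and at 2k; at \<delta>(2k) both have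
  \<open>jj\<close> at 2k.\<close>

lemma r_sum_b_even:
  assumes b: "b \<in> decreasing_borels m n"
  shows "r_sum m n b = r_sum m n (b_even m n b) + wsum m n (r_odd m n b) {1..n}"
proof -
  define s where "s = wsum m n (r_odd m n b) {1..n}"
  have "s \<in> carrier_vec (m + 2 * n)" unfolding s_def by (rule wsum_carrier) simp
  then have dim: "dim_vec s = m + 2 * n" "dim_vec (r_sum m n b') = m + 2 * n" for b'
    using r_sum_carrier by (blast dest: carrier_vecD)+
  have "r_sum m n b $ c = r_sum m n (b_even m n b) $ c + s $ c" if c: "c < m + 2 * n" for c
  proof -
    have sc: "s $ c = (\<Sum>k = 1..n. r_odd m n b k $ c)" unfolding s_def using c by (intro wsum_index) simp_all
    show ?thesis
    proof (cases "c < m")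
      case True
      let ?l = "ell n b (Suc c)"
      \<comment> \<open>An odd \<open>?l\<close> equals \<open>2 * k - 1\<close> for exactly one
        \<open>k\<close>, namely \<open>Suc (?l div 2)\<close>; an even one for none.\<close>
      have "s $ c = (\<Sum>k = 1..n. if k = Suc (?l div 2) then if odd ?l then -1 else 0 else 0)"
        unfolding sc using r_odd_index[OF b _ c] True by (intro sum.cong) (auto elim: oddE)
      also have "\<dots> = (if odd ?l then -1 else 0)"
      proof -
        have "Suc (?l div 2) \<le> n" if "odd ?l" using ell_le[of n b "Suc c"] that by presburger
        then show ?thesis by auto
      qed
      finally have "s $ c = - of_nat (?l mod 2)" by (simp add: odd_iff_mod_2_eq_one even_iff_mod_2_eq_zero)
      moreover have "?l = 2 * (?l div 2) + ?l mod 2" by simp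
      then have "(of_nat ?l :: complex) = of_nat (2 * (?l div 2)) + of_nat (?l mod 2)"
        by (metis of_nat_add)
      moreover have "ell n (b_even m n b) (Suc c) = 2 * (?l div 2)"
        using ell_b_even[OF b, of "Suc c"] True by simp
      ultimately show ?thesis using True by (simp add: r_sum_index_Eps)
    next
      case False
      define j where "j = c - m"
      have j: "c = m + j" "j < 2 * n" using False c by (auto simp: j_def)
      have even_card: "{i \<in> {1..m}. j < ell n (b_even m n b) i} = {i \<in> {1..m}. j < 2 * (ell n b i div 2)}"
        using ell_b_even[OF b] by auto
      show ?thesis
      \<comment> \<open>As \<open>j\<close> is 0-based, even \<open>j\<close> means some
        \<delta>(2k-1), and odd \<open>j\<close> means some \<delta>(2k), where every
        \<open>r_odd\<close> vanishes.\<close>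
      proof (cases "even j")
        case True
        then obtain q where q: "j = 2 * q" by blast
        have "s $ c = (\<Sum>k = 1..n. if k = Suc q then of_nat (jj m b (j + 1)) - of_nat (jj m b (j + 2)) else 0)"
          unfolding sc using r_odd_index[OF b _ c] j q by (intro sum.cong) auto
        also have "\<dots> = of_nat (jj m b (j + 1)) - of_nat (jj m b (j + 2))" using q j by simp
        finally have "s $ c = of_nat (jj m b (j + 1)) - of_nat (jj m b (j + 2))" .
        moreover have "jj m b (j + 1) = card {i \<in> {1..m}. j < ell n b i}"
          using jj_eq_card_ell[OF b, of "j + 1"] j by (simp add: Suc_le_eq)
        moreover have "j + 2 \<le> ell n b i \<longleftrightarrow> j < 2 * (ell n b i div 2)" for i
          using q by auto
        then have "jj m b (j + 2) = card {i \<in> {1..m}. j < ell n (b_even m n b) i}"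
          unfolding even_card using jj_eq_card_ell[OF b, of "j + 2"] j q by simp
        ultimately show ?thesis using j by (simp add: r_sum_index_Del)
      next
        case odd: False
        have "c \<noteq> m + 2 * k - 2" if "k \<in> {1..n}" for k
        proof
          assume "c = m + 2 * k - 2"
          then have "j + 2 = 2 * k" using j that by auto
          then show False using odd by presburger
        qed
        then have "s $ c = 0"
          unfolding sc using r_odd_index[OF b _ c] False by (intro sum.neutral) simp
        moreover have "j < ell n b i \<longleftrightarrow> j < 2 * (ell n b i div 2)" for i
          using odd by presburger
        then have "{i \<in> {1..m}. j < ell n b i} = {i \<in> {1..m}. j < ell n (b_even m n b) i}"
          unfolding even_card by blast
        ultimately show ?thesis using j by (simp add: r_sum_index_Del)
      qed
    qed
  qed
  then show ?thesis unfolding s_def[symmetric] by (intro eq_vecI) (simp_all add: dim)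
qed

section \<open>The action of the matrices in \<open>CC\<close>\<close>

lemma sum_lessThan_double:
  fixes f :: "nat \<Rightarrow> 'a::comm_monoid_add"
  shows "sum f {..<2 * n} = (\<Sum>k<n. f (2 * k) + f (2 * k + 1))"
  by (induction n) (simp_all add: add.assoc)

lemma sum_lessThan_add:
  fixes f :: "nat \<Rightarrow> 'a::comm_monoid_add"
  shows "sum f {..<m + n} = sum f {..<m} + (\<Sum>k<n. f (m + k))"
  by (induction n) (simp_all add: add.assoc)

lemma M0_carrier: "M0 m n \<in> carrier_mat (m + n) (m + 2 * n)"
  by (simp add: M0_def)

lemma zero_left_carrier:
  "A \<in> carrier_mat (m + n) (2 * n) \<Longrightarrow> zero_left m n A \<in> carrier_mat (m + n) (m + 2 * n)"
  unfolding zero_left_def four_block_mat_def carrier_mat_def by (auto simp: Let_def)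

lemma CC_carrier: "M \<in> CC m n \<Longrightarrow> M \<in> carrier_mat (m + n) (m + 2 * n)"
  unfolding CC_def using M0_carrier zero_left_carrier by fastforce

text \<open>The added matrix kills \<open>v\<close>: its zero block removes the
  \<epsilon>-coordinates, and its opposite columns cancel against the equal coordinates of each
  \<delta>-pair.\<close>

lemma CC_mult_paired:
  assumes M: "M \<in> CC m n" and v: "v \<in> carrier_vec (m + 2 * n)"
    and paired: "\<And>k. k < n \<Longrightarrow> v $ (m + (2 * k + 1)) = v $ (m + 2 * k)"
  shows "M *\<^sub>v v = M0 m n *\<^sub>v v"
proof -
  obtain A where A: "A \<in> carrier_mat (m + n) (2 * n)"
    and cols: "\<And>k. k \<in> {1..n} \<Longrightarrow> col A (2 * k - 1) = - col A (2 * k - 2)"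
    and M_eq: "M = M0 m n + zero_left m n A"
    using M unfolding CC_def by blast
  note Z = zero_left_carrier[OF A]
  have "zero_left m n A *\<^sub>v v = 0\<^sub>v (m + n)"
  proof (rule eq_vecI)
    fix r assume "r < dim_vec (0\<^sub>v (m + n) :: complex vec)"
    then have r: "r < m + n" by simp
    have entry: "zero_left m n A $$ (r, c) = (if c < m then 0 else A $$ (r, c - m))" if "c < m + 2 * n" for c
      using r that A by (auto simp: zero_left_def four_block_mat_def Let_def)
    have opp: "A $$ (r, 2 * k + 1) = - A $$ (r, 2 * k)" if "k < n" for k
    proof -
      \<comment> \<open>The k-th pair counted from 0 is the pair \<open>Suc k\<close> of the
        definition of \<open>CC\<close>.\<close>
      have "col A (2 * k + 1) $ r = (- col A (2 * k)) $ r" using cols[of "Suc k"] that by simp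
      then show ?thesis using A r that by simp
    qed
    have "(zero_left m n A *\<^sub>v v) $ r = (\<Sum>c<m + 2 * n. zero_left m n A $$ (r, c) * v $ c)"
      using r Z v by (auto simp: scalar_prod_def lessThan_atLeast0 intro!: sum.cong)
    also have "\<dots> = (\<Sum>k<n. A $$ (r, 2 * k) * v $ (m + 2 * k) + A $$ (r, 2 * k + 1) * v $ (m + (2 * k + 1)))"
      unfolding sum_lessThan_add sum_lessThan_double by (simp add: entry)
    also have "\<dots> = 0"
    proof (rule sum.neutral, rule ballI)
      fix k assume "k \<in> {..<n}"
      then have "k < n" by simp
      then show "A $$ (r, 2 * k) * v $ (m + 2 * k) + A $$ (r, 2 * k + 1) * v $ (m + (2 * k + 1)) = 0"
        by (simp only: paired opp) simp
    qed
    finally show "(zero_left m n A *\<^sub>v v) $ r = 0\<^sub>v (m + n) $ r" using r by simp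
  qed (use Z in simp)
  then have "M *\<^sub>v v = M0 m n *\<^sub>v v + 0\<^sub>v (m + n)"
    unfolding M_eq using add_mult_distrib_mat_vec[OF M0_carrier Z v] by simp
  then show ?thesis using M0_carrier v by (metis mult_mat_vec_carrier right_zero_vec)
qed

lemma mult_wsum_eq_0:
  assumes M: "M \<in> carrier_mat r (m + 2 * n)" and "finite F"
    and f: "\<And>i. i \<in> F \<Longrightarrow> f i \<in> carrier_vec (m + 2 * n)" "\<And>i. i \<in> F \<Longrightarrow> M *\<^sub>v f i = 0\<^sub>v r"
  shows "M *\<^sub>v wsum m n f F = 0\<^sub>v r"
  using assms(2) f
proof (induction F rule: finite_induct)
  case empty
  show ?case using M by (intro eq_vecI) (auto simp: finsum_vec_empty)
next
  case (insert x F)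
  have "wsum m n f (insert x F) = f x + wsum m n f F"
    using insert.prems insert.hyps by (intro finsum_vec_insert) auto
  then show ?case
    using insert mult_add_distrib_mat_vec[OF M, of "f x" "wsum m n f F"] by (simp add: wsum_carrier)
qed

section \<open>Vectors with equal paired coordinates, and the identity itself\<close>

lemma lambda0_paired:
  assumes k: "k < n"
  shows "lambda0 m n l $ (m + (2 * k + 1)) = lambda0 m n l $ (m + 2 * k)"
proof -
  let ?e = "\<lambda>i. (2 * of_nat (l i)) \<cdot>\<^sub>v eps m n i"
    and ?d = "\<lambda>j. of_int (mu_part m l j) \<cdot>\<^sub>v (del m n (2 * j - 1) + del m n (2 * j))"
  have carr: "wsum m n ?e {1..m} \<in> carrier_vec (m + 2 * n)" "wsum m n ?d {1..n} \<in> carrier_vec (m + 2 * n)"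
    by (rule wsum_carrier, simp)+
  have idx: "lambda0 m n l $ c = - (\<Sum>i = 1..m. ?e i $ c) - (\<Sum>j = 1..n. ?d j $ c)" if "c < m + 2 * n" for c
    using that carrier_vecD[OF carr(1)] carrier_vecD[OF carr(2)] wsum_index[of "{1..m}" c m n ?e]
      wsum_index[of "{1..n}" c m n ?d] by (simp add: lambda0_def)
  have e: "?e i $ (m + (2 * k + 1)) = ?e i $ (m + 2 * k)" if "i \<in> {1..m}" for i
  proof -
    have "i - 1 < m" using that by auto
    then show ?thesis using k by (simp add: wt_def)
  qed
  have d: "?d j $ (m + (2 * k + 1)) = ?d j $ (m + 2 * k)" if j: "j \<in> {1..n}" for j
  proof -
    \<comment> \<open>With \<open>j = Suc p\<close> the pair of \<delta>'s sits at
      \<open>m + 2 * p\<close> and \<open>m + (2 * p + 1)\<close>; by parity its first member never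
      meets the second place of another pair, nor conversely.\<close>
    obtain p where "j = Suc p" using j by (cases j) simp_all
    moreover have "Suc (2 * k) \<noteq> 2 * p" "2 * k \<noteq> Suc (2 * p)" by presburger+
    ultimately show ?thesis using j k by (simp add: wt_def)
  qed
  have "m + (2 * k + 1) < m + 2 * n" "m + 2 * k < m + 2 * n" using k by simp_all
  then show ?thesis by (simp only: idx sum.cong[OF refl e] sum.cong[OF refl d])
qed

text \<open>The counts of the even Borel are even, so exceeding \<open>2 * k\<close> already means
  exceeding \<open>2 * k + 1\<close>.\<close>

lemma r_sum_b_even_paired:
  assumes b: "b \<in> decreasing_borels m n" and k: "k < n"
  shows "r_sum m n (b_even m n b) $ (m + (2 * k + 1)) = r_sum m n (b_even m n b) $ (m + 2 * k)"
proof -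
  have "2 * k + 1 < ell n (b_even m n b) i \<longleftrightarrow> 2 * k < ell n (b_even m n b) i" if "i \<in> {1..m}" for i
    unfolding ell_b_even[OF b that] by presburger
  then have "{i \<in> {1..m}. 2 * k + 1 < ell n (b_even m n b) i} = {i \<in> {1..m}. 2 * k < ell n (b_even m n b) i}"
    by blast
  then show ?thesis using k r_sum_index_Del[of "2 * k + 1" n m] r_sum_index_Del[of "2 * k" n m] by simp
qed

theorem proposition5p9:
  fixes m n :: nat
    and b :: "letter list"
    and lam :: "nat \<Rightarrow> nat"
    and W :: "'v::ab_group_add supermodule"
  assumes "b \<in> decreasing_borels m n"
    and "lam \<in> hook_partitions m n"
    and "is_W m n lam W"
    and "generic m n b lam W"
  shows "\<forall>M \<in> C_b m n b.
    M *\<^sub>v highest_weight m n W b + X_shift m n b = M0 m n *\<^sub>v lambda0 m n lam + X_vec m n (b_op m n)"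
proof
  fix M assume "M \<in> C_b m n b"
  then have M: "M \<in> CC m n" and odd: "\<And>k. k \<in> T_set m n b \<Longrightarrow> M *\<^sub>v r_odd m n b k = 0\<^sub>v (m + n)"
    unfolding C_b_def by auto
  note b = assms(1) and carr = CC_carrier[OF M] and M0 = M0_carrier[of m n]
  let ?be = "b_even m n b" and ?s = "wsum m n (r_odd m n b) {1..n}"
  have s: "?s \<in> carrier_vec (m + 2 * n)" by (rule wsum_carrier) simp
  have "M *\<^sub>v r_odd m n b k = 0\<^sub>v (m + n)" if "k \<in> {1..n}" for k
  proof (cases "k \<in> T_set m n b")
    case False
    then have "r_odd m n b k = 0\<^sub>v (m + 2 * n)" using r_odd_eq_0[OF b] that by blast
    then show ?thesis using carr by (intro eq_vecI) auto
  qed (rule odd)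
  then have "M *\<^sub>v ?s = 0\<^sub>v (m + n)" by (intro mult_wsum_eq_0[OF carr]) simp_all
  then have "M *\<^sub>v r_sum m n b = M *\<^sub>v r_sum m n ?be + 0\<^sub>v (m + n)"
    unfolding r_sum_b_even[OF b] using mult_add_distrib_mat_vec[OF carr r_sum_carrier s] by simp
  also have "M *\<^sub>v r_sum m n ?be = M0 m n *\<^sub>v r_sum m n ?be"
    by (rule CC_mult_paired[OF M r_sum_carrier r_sum_b_even_paired[OF b]])
  finally have r: "M *\<^sub>v r_sum m n b = M0 m n *\<^sub>v r_sum m n ?be + 0\<^sub>v (m + n)" .
  \<comment> \<open>Genericity splits the highest weight; on \<open>lambda0\<close>, whose
    \<delta>-coordinates are paired, \<open>M\<close> acts as \<open>M0\<close>.\<close>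
  have hw: "M *\<^sub>v highest_weight m n W b = M0 m n *\<^sub>v lambda0 m n lam - M *\<^sub>v r_sum m n b"
    using assms(4) CC_mult_paired[OF M lambda0_carrier lambda0_paired]
      mult_minus_distrib_mat_vec[OF carr lambda0_carrier r_sum_carrier]
    by (simp add: generic_def)
  \<comment> \<open>\<open>X_shift\<close> is taken at the even Borel, so it contributes exactly the
    term that \<open>r\<close> subtracts through \<open>hw\<close>.\<close>
  have X: "X_shift m n b = X_vec m n (b_op m n) + M0 m n *\<^sub>v r_sum m n ?be"
    unfolding X_shift_def X_vec_def weyl_vector_decreasing[OF b_even_decreasing[OF b]]
    by (rule mult_add_distrib_mat_vec[OF M0 weyl_vector_carrier r_sum_carrier])
  have "dim_vec (X_vec m n (b_op m n)) = m + n" using M0 by (simp add: X_vec_def)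
  then show "M *\<^sub>v highest_weight m n W b + X_shift m n b =
      M0 m n *\<^sub>v lambda0 m n lam + X_vec m n (b_op m n)"
    unfolding hw X r using M0 by (intro eq_vecI) (auto simp del: index_mult_mat_vec)
qed

end
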